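(* Let $n,k,k'\in\mathbb N_0$ with $n+k\ge1$ and $n+k'\ge1$. Then $$\int_{-1}^{1}{\sf Q}_{k+n-\frac12}^{n-\frac12}(x)\,{\sf Q}_{k'+n-\frac12}^{n-\frac12}(x)\,\mathrm dx=\frac{\pi^2\,(2n+k-1)!}{4(n+k)\,k!}\,\delta_{k,k'}.$$
   Context: $\mathbb N_0=\{0,1,2,\ldots\}$, and $\delta_{k,k'}$ is the Kronecker delta. For $x\in(-1,1)$ the Ferrers function of the first kind is $${\sf P}_\nu^{-\mu}(x)=\left(\frac{1-x}{1+x}\right)^{\frac{\mu}{2}}\sum_{j=0}^\infty\frac{(-\nu)_j(\nu+1)_j}{\Gamma(\mu+1+j)\,j!}\left(\frac{1-x}{2}\right)^j ,$$ with $(a)_0=1$, $(a)_j=a(a+1)\cdots(a+j-1)$ and $1/\Gamma$ the entire reciprocal gamma function, i.e. ${\sf P}_\nu^{-\mu}(x)=\frac{1}{\Gamma(\mu+1)}\left(\frac{1-x}{1+x}\right)^{\mu/2}{}_2F_1\left(-\nu,\nu+1;\mu+1;\frac{1-x}{2}\right)$. The Ferrers function of the second kind is, for $\mu\notin\mathbb Z$, $${\sf Q}_\nu^\mu(x)=\frac{\pi}{2\sin(\pi\mu)}\left(\cos(\pi\mu)\,{\sf P}_\nu^{\mu}(x)-\frac{\Gamma(\nu+\mu+1)}{\Gamma(\nu-\mu+1)}\,{\sf P}_\nu^{-\mu}(x)\right).$$ *)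

theory Defs
  imports "HOL-Analysis.Analysis"
begin

text \<open>
  Ferrers functions of the first and second kind, \<open>P\<^sub>\<nu>\<^sup>\<mu>(x)\<close> and \<open>Q\<^sub>\<nu>\<^sup>\<mu>(x)\<close>, for real degree
  \<open>\<nu>\<close>, real order \<open>\<mu>\<close> and \<open>-1 < x < 1\<close>.

  The series is usually written for \<open>P\<^sub>\<nu>\<^sup>-\<^sup>\<mu>\<close>; here \<open>\<mu>\<close> has been replaced by \<open>-\<mu>\<close>, so that
  the second argument is the upper index itself. The function \<^const>\<open>rGamma\<close> is the
  entire function \<open>1/\<Gamma>\<close>.
\<close>

definition ferrers_P :: "real \<Rightarrow> real \<Rightarrow> real \<Rightarrow> real" where
  "ferrers_P \<nu> \<mu> x =
     ((1 - x) / (1 + x)) powr (- \<mu> / 2) *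
     (\<Sum>j. pochhammer (- \<nu>) j * pochhammer (\<nu> + 1) j * rGamma (- \<mu> + 1 + real j) / fact j
            * ((1 - x) / 2) ^ j)"

text \<open>
  Meaningful only for \<open>\<mu>\<close> not an integer and \<open>\<nu> + \<mu> + 1\<close> not a pole of \<open>\<Gamma>\<close>.
\<close>

definition ferrers_Q :: "real \<Rightarrow> real \<Rightarrow> real \<Rightarrow> real" where
  "ferrers_Q \<nu> \<mu> x =
     pi / (2 * sin (pi * \<mu>)) *
     (cos (pi * \<mu>) * ferrers_P \<nu> \<mu> x
      - Gamma (\<nu> + \<mu> + 1) / Gamma (\<nu> - \<mu> + 1) * ferrers_P \<nu> (- \<mu>) x)"

end

theory Submission
  imports Defs
begin

text \<open>
  Put \<open>\<mu> = n - 1/2\<close> and \<open>\<nu> = k + \<mu>\<close>. Since \<open>cos (\<pi>\<mu>) = 0\<close> and \<open>sin (\<pi>\<mu>) = -(-1)\<^sup>n\<close>, the function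
  \<open>Q\<^sub>\<nu>\<^sup>\<mu>\<close> is a constant multiple of \<open>P\<^sub>\<nu>\<^sup>-\<^sup>\<mu>\<close>. Euler's transformation
  \[ {}_2F_1(a,b;c;t) = (1-t)^{c-a-b} {}_2F_1(c-a,c-b;c;t) \]
  turns the hypergeometric series in \<open>P\<^sub>\<nu>\<^sup>-\<^sup>\<mu>\<close> into \<open>(1-t)\<^sup>\<mu>\<close> times a series that terminates after the
  power \<open>t\<^sup>k\<close>, because \<open>\<mu> - \<nu> = -k\<close>. So \<open>P\<^sub>\<nu>\<^sup>-\<^sup>\<mu>(x)\<close> is a constant times \<open>(1 - x\<^sup>2)\<close> to the power \<open>\<mu>/2\<close>
  times the Gegenbauer polynomial of degree \<open>k\<close> and parameter \<open>n\<close> (\<open>ferrers_P_eq_gegenbauer\<close>), and the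
  assertion states the orthogonality and the norms of these polynomials for the weight
  \<open>(1 - x\<^sup>2)\<close> to the power \<open>n - 1/2\<close>.

  Euler's transformation is proved for formal power series: both sides have constant term 1 and solve
  the hypergeometric differential equation, which amounts to a recurrence that determines the
  coefficients.

  For the Gegenbauer polynomials \<open>U\<^sub>k\<close> with parameter \<open>\<lambda> > -1/2\<close>, integrating the derivative of
  \<open>(1 - x\<^sup>2)\<^bsup>\<lambda> + 1/2\<^esup> U\<^sub>i' U\<^sub>j\<close> gives
  \[ \int (1-x^2)^{\lambda+1/2} U_i' U_j' = i(i+2\lambda) \int (1-x^2)^{\lambda-1/2} U_i U_j \]
  over \<open>(-1,1)\<close> (\<open>gegenbauer_by_parts\<close>). The left-hand side is symmetric in \<open>i\<close> and \<open>j\<close>, which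
  yields orthogonality. For \<open>i = j = k + 1\<close>, as \<open>U\<^sub>i'\<close> is a multiple of the polynomial of degree \<open>k\<close>
  with parameter \<open>\<lambda> + 1\<close>, it expresses the norm in terms of one with lower degree. The
  computation of the norms ends at the integral of the weight itself, which another integration by
  parts reduces to the integral \<open>\<pi>\<close> of the derivative of \<open>arcsin\<close>.
\<close>

unbundle no vec_syntax and fps_syntax

section \<open>Euler's transformation of the hypergeometric series\<close>

lemma pochhammer_nonzero:
  fixes c :: real
  assumes c: "\<And>j::nat. c + real j \<noteq> 0"
  shows "pochhammer c j \<noteq> 0"
proof
  assume "pochhammer c j = 0"
  then obtain i where "c = - real i"
    by (auto simp: pochhammer_eq_0_iff)
  with c[of i] show False by simp
qed

lemma fps_hypergeo_nth_Suc:
  fixes a b c :: real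
  assumes c: "\<And>j::nat. c + real j \<noteq> 0"
  defines "H \<equiv> fps_hypergeo [a, b] [c] 1"
  shows "(real j + 1) * (c + real j) * H $ Suc j = (a + real j) * (b + real j) * H $ j"
proof -
  define pa pb pc where "pa = pochhammer a j" and "pb = pochhammer b j" and "pc = pochhammer c j"
  have fact: "fact (Suc j) = (real j + 1) * fact j"
    by (simp add: algebra_simps)
  have H: "H $ j = pa * pb / (pc * fact j)"
      "H $ Suc j = (pa * (a + real j)) * (pb * (b + real j)) / ((pc * (c + real j)) * ((real j + 1) * fact j))"
    by (simp_all add: H_def pochhammer_Suc fact pa_def pb_def pc_def del: fact_Suc)
  have "pc \<noteq> 0" "c + real j \<noteq> 0" "real j + 1 \<noteq> 0"
    using c pochhammer_nonzero[OF c] by (auto simp: pc_def)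
  then show ?thesis
    unfolding H by simp
qed

text \<open>
  The hypergeometric differential equation characterises the hypergeometric series up to its constant
  term, because comparing coefficients gives the recurrence of \<open>fps_hypergeo_nth_Suc\<close>.
\<close>
lemma fps_hypergeo_unique:
  fixes a b c :: real and F :: "real fps"
  assumes c: "\<And>j::nat. c + real j \<noteq> 0"
  shows "fps_X * (1 - fps_X) * fps_deriv (fps_deriv F)
           + (fps_const c - fps_const (a + b + 1) * fps_X) * fps_deriv F = fps_const (a * b) * F
         \<longleftrightarrow> F = fps_const (F $ 0) * fps_hypergeo [a, b] [c] 1"
    (is "?L = ?R \<longleftrightarrow> F = ?H")
proof -
  have L: "?L $ j = (real j + 1) * (c + real j) * F $ Suc j
             + (a * b - (a + real j) * (b + real j)) * F $ j" for j
  proof -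
    have "?L = fps_X * fps_deriv (fps_deriv F) - fps_X * (fps_X * fps_deriv (fps_deriv F))
          + (fps_const c * fps_deriv F - fps_const (a + b + 1) * (fps_X * fps_deriv F))"
      by (simp add: algebra_simps)
    then show ?thesis
      by (cases j; cases "j - 1") (simp_all add: fps_mult_left_const_nth algebra_simps)
  qed
  have "?L = ?R \<longleftrightarrow> (\<forall>j. (real j + 1) * (c + real j) * F $ Suc j = (a + real j) * (b + real j) * F $ j)"
    unfolding fps_eq_iff L by (simp add: algebra_simps)
  also have "\<dots> \<longleftrightarrow> F = ?H"
  proof
    assume rec: "\<forall>j. (real j + 1) * (c + real j) * F $ Suc j = (a + real j) * (b + real j) * F $ j"
    have "F $ j = ?H $ j" for j
    proof (induction j)
      case (Suc j)
      have "(real j + 1) * (c + real j) * F $ Suc j = (real j + 1) * (c + real j) * ?H $ Suc j"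
        using rec fps_hypergeo_nth_Suc[OF c, of j a b] Suc.IH
        by (simp only: fps_mult_left_const_nth mult.left_commute[of _ "F $ 0"])
      moreover have "(real j + 1) * (c + real j) \<noteq> 0"
        using c by (simp add: add_eq_0_iff)
      ultimately show ?case
        by (metis mult_left_cancel)
    qed simp
    then show "F = ?H" by (rule fps_ext)
  next
    assume "F = ?H"
    then have "F $ j = F $ 0 * fps_hypergeo [a, b] [c] 1 $ j" for j
      by (metis fps_mult_left_const_nth)
    then show "\<forall>j. (real j + 1) * (c + real j) * F $ Suc j = (a + real j) * (b + real j) * F $ j"
      using fps_hypergeo_nth_Suc[OF c, of _ a b] by (metis mult.left_commute)
  qed
  finally show ?thesis .
qed

lemma fps_hypergeo_ODE:
  fixes a b c :: real
  assumes c: "\<And>j::nat. c + real j \<noteq> 0"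
  defines "F \<equiv> fps_hypergeo [a, b] [c] 1"
  shows "fps_X * (1 - fps_X) * fps_deriv (fps_deriv F)
           + (fps_const c - fps_const (a + b + 1) * fps_X) * fps_deriv F = fps_const (a * b) * F"
  using fps_hypergeo_unique[OF c, where F = F and a = a and b = b] by (simp add: F_def)

text \<open>The binomial series of \<open>(1 - t)\<^sup>s\<close>.\<close>
definition fps_one_minus_powr :: "real \<Rightarrow> real fps" where
  "fps_one_minus_powr s = Abs_fps (\<lambda>j. pochhammer (- s) j / fact j)"

lemma fps_deriv_one_minus_powr:
  "(1 - fps_X) * fps_deriv (fps_one_minus_powr s) = - fps_const s * fps_one_minus_powr s"
proof -
  let ?W = "fps_one_minus_powr s"
  have rec: "(real j + 1) * ?W $ Suc j = (real j - s) * ?W $ j" for j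
  proof -
    have "real j + 1 \<noteq> 0" by linarith
    then show ?thesis
      by (simp add: fps_one_minus_powr_def pochhammer_Suc add.commute[of 1])
  qed
  have "(1 - fps_X) * fps_deriv ?W = fps_deriv ?W - fps_X * fps_deriv ?W"
    by (simp add: algebra_simps)
  also have "\<dots> $ j = (- fps_const s * ?W) $ j" for j
    using rec[of j] by (cases j) (simp_all add: algebra_simps)
  then have "fps_deriv ?W - fps_X * fps_deriv ?W = - fps_const s * ?W"
    by (rule fps_ext)
  finally show ?thesis .
qed

lemma sums_one_minus_powr:
  assumes "\<bar>t\<bar> < 1"
  shows "(\<lambda>j. fps_one_minus_powr s $ j * t ^ j) sums (1 - t) powr s"
proof -
  have "(s gchoose j) * (- t) ^ j = fps_one_minus_powr s $ j * t ^ j" for j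
    by (simp add: fps_one_minus_powr_def gbinomial_pochhammer power_minus')
  then show ?thesis
    using gen_binomial_real[of "- t" s] assms by simp
qed

lemma eval_fps_one_minus_powr: "\<bar>t\<bar> < 1 \<Longrightarrow> eval_fps (fps_one_minus_powr s) t = (1 - t) powr s"
  unfolding eval_fps_def by (rule sums_unique[symmetric], rule sums_one_minus_powr)

lemma fps_conv_radius_one_minus_powr: "fps_conv_radius (fps_one_minus_powr s) \<ge> 1"
  unfolding fps_conv_radius_def
proof (rule conv_radius_geI_ex')
  fix r :: real assume "0 < r" "ereal r < 1"
  then show "summable (\<lambda>j. fps_one_minus_powr s $ j * of_real r ^ j)"
    using sums_summable[OF sums_one_minus_powr[of r s]] by simp
qed

text \<open>
  The algebra behind Euler's transformation, with \<open>W1\<close>, \<open>W2\<close>, \<open>G1\<close>, \<open>G2\<close> in the roles of the first and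
  second derivatives of \<open>W = (1 - X)\<^sup>s\<close> and of \<open>G\<close>: if \<open>G\<close> solves the hypergeometric equation
  with parameters \<open>c - a\<close>, \<open>c - b\<close>, \<open>c\<close>, then \<open>W G\<close> solves the one with parameters \<open>a\<close>, \<open>b\<close>, \<open>c\<close>. Both
  sides carry a factor \<open>D = 1 - X\<close>, which clears the denominators of \<open>W1\<close> and \<open>W2\<close>.
\<close>
lemma hypergeo_ODE_Euler:
  fixes W W1 W2 G G1 G2 D X a b c s :: "'a::comm_ring_1"
  assumes D: "D = 1 - X" and W1: "D * W1 = - s * W" and W2: "D * W2 = (1 - s) * W1"
    and s: "s = c - a - b"
    and G: "X * D * G2 + (c - ((c - a) + (c - b) + 1) * X) * G1 = (c - a) * (c - b) * G"
  shows "D * (X * D * (W2 * G + 2 * W1 * G1 + W * G2)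
             + (c - (a + b + 1) * X) * (W1 * G + W * G1))
           = D * (a * b * (W * G))"
proof -
  have DD: "D * D * W2 = - (1 - s) * s * W" using W1 W2
    by (metis (no_types, lifting) mult.assoc mult.left_commute mult_minus_left mult_minus_right)
  have "D * (X * D * (W2 * G + 2 * W1 * G1 + W * G2)
              + (c - (a + b + 1) * X) * (W1 * G + W * G1))
    = X * (D * D * W2) * G + 2 * X * D * (D * W1) * G1 + D * W * (X * D * G2)
      + (c - (a + b + 1) * X) * ((D * W1) * G + D * W * G1)"
    by (simp add: algebra_simps)
  also have "X * D * G2 = (c - a) * (c - b) * G - (c - ((c - a) + (c - b) + 1) * X) * G1"
    using G by (simp add: algebra_simps)
  finally show ?thesis unfolding DD W1 unfolding s D by (simp add: algebra_simps)
qed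

theorem fps_hypergeo_Euler:
  fixes a b c :: real
  assumes c: "\<And>j::nat. c + real j \<noteq> 0"
  shows "fps_hypergeo [a, b] [c] 1
           = fps_one_minus_powr (c - a - b) * fps_hypergeo [c - a, c - b] [c] 1"
proof -
  define W where "W = fps_one_minus_powr (c - a - b)"
  define G where "G = fps_hypergeo [c - a, c - b] [c] 1"
  define s where "s = fps_const (c - a - b)"
  define D where "D = (1 - fps_X :: real fps)"
  have W1: "D * fps_deriv W = - s * W"
    unfolding W_def s_def D_def by (rule fps_deriv_one_minus_powr)
  have s': "fps_deriv s = 0" by (simp add: s_def)
  have W2: "D * fps_deriv (fps_deriv W) = (1 - s) * fps_deriv W"
    using arg_cong[OF W1, of fps_deriv] s' by (simp add: D_def algebra_simps)
  define A B C where "A = fps_const a" and "B = fps_const b" and "C = fps_const c"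
  have s_eq: "s = C - A - B"
    by (simp add: s_def A_def B_def C_def)
  have coeff_eqs: "fps_const (a * b) = A * B" "fps_const (a + b + 1) = A + B + 1"
      "fps_const ((c - a) * (c - b)) = (C - A) * (C - B)"
      "fps_const ((c - a) + (c - b) + 1) = (C - A) + (C - B) + 1"
    by (simp_all add: A_def B_def C_def flip: fps_const_add fps_const_sub fps_const_mult)
  have G_ode: "fps_X * D * fps_deriv (fps_deriv G) + (C - ((C - A) + (C - B) + 1) * fps_X) * fps_deriv G
               = (C - A) * (C - B) * G"
    using fps_hypergeo_ODE[OF c, of "c - a" "c - b"] unfolding coeff_eqs
    by (simp only: G_def D_def C_def)
  have H2: "fps_deriv (fps_deriv (W * G))
        = fps_deriv (fps_deriv W) * G + 2 * fps_deriv W * fps_deriv G + W * fps_deriv (fps_deriv G)"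
    by (simp add: algebra_simps)
  have H1: "fps_deriv (W * G) = fps_deriv W * G + W * fps_deriv G"
    by simp
  have "D * (fps_X * D * fps_deriv (fps_deriv (W * G))
           + (C - fps_const (a + b + 1) * fps_X) * fps_deriv (W * G)) = D * (fps_const (a * b) * (W * G))"
    unfolding coeff_eqs H2 unfolding H1 using hypergeo_ODE_Euler[OF D_def W1 W2 s_eq G_ode] .
  moreover have "D \<noteq> 0" by (auto simp: D_def)
  ultimately have "W * G = fps_const ((W * G) $ 0) * fps_hypergeo [a, b] [c] 1"
    unfolding D_def C_def by (subst fps_hypergeo_unique[OF c, symmetric]) simp_all
  then show ?thesis unfolding W_def G_def by (simp add: fps_one_minus_powr_def)
qed

section \<open>Gegenbauer polynomials\<close>

text \<open>The series \<open>\<^sub>2F\<^sub>1(-k, b; c; t)\<close>, which terminates, as a polynomial in \<open>t\<close>.\<close>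
definition hypergeo_poly :: "nat \<Rightarrow> real \<Rightarrow> real \<Rightarrow> real poly" where
  "hypergeo_poly k b c =
     (\<Sum>j\<le>k. monom (pochhammer (- real k) j * pochhammer b j / (pochhammer c j * fact j)) j)"

lemma coeff_hypergeo_poly:
  "coeff (hypergeo_poly k b c) j = pochhammer (- real k) j * pochhammer b j / (pochhammer c j * fact j)"
  by (cases "j \<le> k")
     (simp_all add: hypergeo_poly_def coeff_sum pochhammer_of_nat_eq_0_lemma)

lemma fps_of_hypergeo_poly: "fps_of_poly (hypergeo_poly k b c) = fps_hypergeo [- real k, b] [c] 1"
  by (simp add: fps_eq_iff coeff_hypergeo_poly)

lemma hypergeo_poly_ODE:
  fixes k :: nat and b c t :: real
  assumes c: "\<And>j::nat. c + real j \<noteq> 0"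
  defines "p \<equiv> hypergeo_poly k b c"
  shows "t * (1 - t) * poly (pderiv (pderiv p)) t + (c - (b + 1 - real k) * t) * poly (pderiv p) t
           = - real k * b * poly p t"
proof -
  have "[:0, 1:] * (1 - [:0, 1:]) * pderiv (pderiv p) + ([:c:] - [:- real k + b + 1:] * [:0, 1:]) * pderiv p
          = [:- real k * b:] * p"
    unfolding fps_of_poly_eq_iff[symmetric]
    using fps_hypergeo_ODE[OF c, of "- real k" b]
    by (simp only: fps_of_poly_add fps_of_poly_diff fps_of_poly_mult fps_of_poly_pderiv
          fps_of_poly_const fps_of_poly_fps_X fps_of_poly_1 p_def fps_of_hypergeo_poly)
  from arg_cong[OF this, of "\<lambda>q. poly q t"] show ?thesis
    by (simp add: algebra_simps)
qed

lemma pderiv_hypergeo_poly: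
  "pderiv (hypergeo_poly (Suc k) b c)
     = smult (- real (Suc k) * b / c) (hypergeo_poly k (b + 1) (c + 1))"
proof (rule poly_eqI)
  fix j
  have fact: "fact (Suc j) = (real j + 1) * fact j"
    by (simp add: algebra_simps)
  have poch: "pochhammer (- real (Suc k)) (Suc j) = - real (Suc k) * pochhammer (- real k) j"
    by (simp add: pochhammer_rec)
  have "real j + 1 \<noteq> 0" by linarith
  then show "coeff (pderiv (hypergeo_poly (Suc k) b c)) j
      = coeff (smult (- real (Suc k) * b / c) (hypergeo_poly k (b + 1) (c + 1))) j"
    unfolding coeff_pderiv coeff_smult coeff_hypergeo_poly fact poch pochhammer_rec[of b] pochhammer_rec[of c]
    by (simp add: add.commute[of 1] divide_simps del: of_nat_Suc)
qed

text \<open>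
  The Gegenbauer (ultraspherical) polynomial of degree \<open>k\<close> with parameter \<open>l\<close>, as a polynomial in \<open>x\<close>:
  \<open>\<^sub>2F\<^sub>1(-k, k + 2l; l + 1/2; (1 - x)/2)\<close>. It is normalised to take the value 1 at \<open>x = 1\<close>, so that \<open>l = 0\<close>
  gives the Chebyshev polynomials of the first kind instead of 0.
\<close>
definition gegenbauer :: "real \<Rightarrow> nat \<Rightarrow> real poly" where
  "gegenbauer l k = hypergeo_poly k (real k + 2 * l) (l + 1/2) \<circ>\<^sub>p [:1/2, -1/2:]"

lemma poly_gegenbauer:
  "poly (gegenbauer l k) x = poly (hypergeo_poly k (real k + 2 * l) (l + 1/2)) ((1 - x) / 2)"
  by (simp add: gegenbauer_def poly_pcompose diff_divide_distrib)

lemma gegenbauer_0 [simp]: "gegenbauer l 0 = 1"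
  by (simp add: gegenbauer_def hypergeo_poly_def pcompose_1)

lemma pderiv_pcompose_half:
  fixes p :: "real poly"
  shows "pderiv (p \<circ>\<^sub>p [:1/2, -1/2:]) = smult (- 1 / 2) (pderiv p \<circ>\<^sub>p [:1/2, -1/2:])"
  by (simp add: pderiv_pcompose pderiv_pCons)

lemma pderiv_gegenbauer_Suc:
  "pderiv (gegenbauer l (Suc k))
     = smult (real (Suc k) * (real (Suc k) + 2 * l) / (2 * l + 1)) (gegenbauer (l + 1) k)"
proof -
  have args: "real (Suc k) + 2 * l + 1 = real k + 2 * (l + 1)" "l + 1 / 2 + 1 = l + 1 + 1 / 2"
    by simp_all
  have factor: "- 1 / 2 * (- real (Suc k) * (real (Suc k) + 2 * l) / (l + 1/2))
      = real (Suc k) * (real (Suc k) + 2 * l) / (2 * l + 1)"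
  proof -
    have "2 * l + 1 = 2 * (l + 1/2)" by simp
    then show ?thesis
      by (simp only: divide_divide_eq_left' times_divide_times_eq)
  qed
  show ?thesis
    unfolding gegenbauer_def
    by (simp only: pderiv_pcompose_half pderiv_hypergeo_poly pcompose_smult smult_smult args factor)
qed

lemma gegenbauer_ODE:
  fixes k :: nat and l x :: real
  assumes "l > - 1 / 2"
  defines "U \<equiv> gegenbauer l k"
  shows "(1 - x\<^sup>2) * poly (pderiv (pderiv U)) x - (2 * l + 1) * x * poly (pderiv U) x
           = - real k * (real k + 2 * l) * poly U x"
proof -
  define p where "p = hypergeo_poly k (real k + 2 * l) (l + 1/2)"
  define t where "t = (1 - x) / 2"
  have "l + 1 / 2 + real j \<noteq> 0" for j
    using assms by linarith
  then have ode: "t * (1 - t) * poly (pderiv (pderiv p)) t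
      + (l + 1/2 - (real k + 2 * l + 1 - real k) * t) * poly (pderiv p) t
      = - real k * (real k + 2 * l) * poly p t"
    unfolding p_def by (rule hypergeo_poly_ODE)
  have "poly [:1/2, -1/2:] x = t"
    by (simp add: t_def diff_divide_distrib)
  then have vals: "poly U x = poly p t" "poly (pderiv U) x = - poly (pderiv p) t / 2"
      "poly (pderiv (pderiv U)) x = poly (pderiv (pderiv p)) t / 4"
    by (simp_all only: U_def gegenbauer_def pderiv_pcompose_half pderiv_smult smult_smult p_def
          poly_smult poly_pcompose)
  have x: "x = 1 - 2 * t"
    by (simp add: t_def field_simps)
  show ?thesis
    unfolding vals unfolding x using ode by (simp add: algebra_simps power2_eq_square add_divide_distrib)
qed

section \<open>Orthogonality and norms of the Gegenbauer polynomials\<close>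

text \<open>The weight for which the Gegenbauer polynomials with parameter \<open>l\<close> are orthogonal on \<open>(-1, 1)\<close>.\<close>
abbreviation gegenbauer_weight :: "real \<Rightarrow> real \<Rightarrow> real" where
  "gegenbauer_weight l x \<equiv> (1 - x\<^sup>2) powr (l - 1/2)"

lemma has_real_derivative_weight:
  fixes x :: real
  assumes "x \<in> {-1<..<1}"
  shows "((\<lambda>x. (1 - x\<^sup>2) powr a) has_real_derivative - 2 * a * x * (1 - x\<^sup>2) powr (a - 1)) (at x)"
proof -
  have "1 - x\<^sup>2 > 0"
    using assms by (simp add: abs_square_less_1 abs_if)
  then show ?thesis
    by (auto intro!: derivative_eq_intros)
qed

lemma weight_Suc:
  assumes "x \<in> {-1<..<1}"
  shows "gegenbauer_weight (l + 1) x = gegenbauer_weight l x * (1 - x\<^sup>2)"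
proof -
  have "1 - x\<^sup>2 > 0"
    using assms by (simp add: abs_square_less_1 abs_if)
  moreover have "l + 1 - 1/2 = l - 1/2 + 1"
    by simp
  ultimately show ?thesis
    by (simp only: powr_add) simp
qed

text \<open>
  The integrand is the derivative of \<open>(1 - x\<^sup>2)\<^sup>a f(x)\<close>, which vanishes at both endpoints.
  It may be unbounded near them if \<open>a < 1\<close>.
\<close>
lemma weighted_FTC:
  fixes f f' :: "real \<Rightarrow> real"
  assumes "a > 0" and f: "\<And>x. (f has_real_derivative f' x) (at x)"
  shows "((\<lambda>x. (1 - x\<^sup>2) powr (a - 1) * ((1 - x\<^sup>2) * f' x - 2 * a * x * f x)) has_integral 0) {-1<..<1}"
proof -
  have "continuous_on {-1..1} (\<lambda>x. (1 - x\<^sup>2) powr a * f x)"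
    using \<open>a > 0\<close> f
    by (intro continuous_intros continuous_on_powr' DERIV_continuous_on[OF has_field_derivative_at_within])
       (auto simp: abs_square_le_1)
  moreover have "((\<lambda>x. (1 - x\<^sup>2) powr a * f x) has_vector_derivative
        (1 - x\<^sup>2) powr (a - 1) * ((1 - x\<^sup>2) * f' x - 2 * a * x * f x)) (at x)" if "x \<in> {-1<..<1}" for x
  proof -
    have "1 - x\<^sup>2 > 0"
      using that by (simp add: abs_square_less_1 abs_if)
    then have "(1 - x\<^sup>2) powr a = (1 - x\<^sup>2) powr (a - 1) * (1 - x\<^sup>2)"
      using powr_add[of "1 - x\<^sup>2" "a - 1" 1] by simp
    with DERIV_mult[OF has_real_derivative_weight[OF that, of a] f[of x]] show ?thesis
      by (simp add: has_real_derivative_iff_has_vector_derivative algebra_simps)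
  qed
  ultimately have "((\<lambda>x. (1 - x\<^sup>2) powr (a - 1) * ((1 - x\<^sup>2) * f' x - 2 * a * x * f x)) has_integral
        ((1 - 1\<^sup>2) powr a * f 1 - (1 - (- 1)\<^sup>2) powr a * f (- 1))) {-1..1}"
    by (intro fundamental_theorem_of_calculus_interior) auto
  then show ?thesis
    by (simp add: has_integral_Icc_iff_Ioo)
qed

text \<open>
  The Gegenbauer equation in self-adjoint form says that the derivative of \<open>(1 - x\<^sup>2)\<^bsup>l + 1/2\<^esup> U\<^sub>i'\<close>
  is \<open>-i (i + 2l) (1 - x\<^sup>2)\<^bsup>l - 1/2\<^esup> U\<^sub>i\<close>; the lemma integrates it against \<open>U\<^sub>j\<close> by parts. A single
  integrand is used because the integrability of its two terms is not yet known.
\<close>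
lemma gegenbauer_by_parts:
  assumes l: "l > - 1 / 2"
  shows "((\<lambda>x. gegenbauer_weight (l + 1) x *
                 (poly (pderiv (gegenbauer l i)) x * poly (pderiv (gegenbauer l j)) x)
             - real i * (real i + 2 * l) *
               (gegenbauer_weight l x * (poly (gegenbauer l i) x * poly (gegenbauer l j) x)))
           has_integral 0) {-1<..<1}"
proof -
  let ?U = "gegenbauer l i" and ?V = "gegenbauer l j"
  let ?f = "\<lambda>x. poly (pderiv ?U * ?V) x" and ?f' = "\<lambda>x. poly (pderiv (pderiv ?U * ?V)) x"
  have eq: "(1 - x\<^sup>2) powr (l + 1/2 - 1) * ((1 - x\<^sup>2) * ?f' x - 2 * (l + 1/2) * x * ?f x)
      = gegenbauer_weight (l + 1) x * (poly (pderiv ?U) x * poly (pderiv ?V) x)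
             - real i * (real i + 2 * l) * (gegenbauer_weight l x * (poly ?U x * poly ?V x))"
    if "x \<in> {-1<..<1}" for x
  proof -
    have "(1 - x\<^sup>2) * ?f' x - 2 * (l + 1/2) * x * ?f x
        = (1 - x\<^sup>2) * (poly (pderiv ?U) x * poly (pderiv ?V) x)
          + ((1 - x\<^sup>2) * poly (pderiv (pderiv ?U)) x - (2 * l + 1) * x * poly (pderiv ?U) x) * poly ?V x"
      by (simp add: pderiv_mult algebra_simps)
    also have "\<dots> = (1 - x\<^sup>2) * (poly (pderiv ?U) x * poly (pderiv ?V) x)
          - real i * (real i + 2 * l) * (poly ?U x * poly ?V x)"
      unfolding gegenbauer_ODE[OF l] by simp
    finally have f: "(1 - x\<^sup>2) * ?f' x - 2 * (l + 1/2) * x * ?f x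
        = (1 - x\<^sup>2) * (poly (pderiv ?U) x * poly (pderiv ?V) x)
          - real i * (real i + 2 * l) * (poly ?U x * poly ?V x)" .
    have "l + 1/2 - 1 = l - 1/2"
      by simp
    then show ?thesis
      by (simp only: f weight_Suc[OF that]) (simp add: algebra_simps)
  qed
  have "((\<lambda>x. (1 - x\<^sup>2) powr (l + 1/2 - 1) * ((1 - x\<^sup>2) * ?f' x - 2 * (l + 1/2) * x * ?f x))
          has_integral 0) {-1<..<1}"
    using l by (intro weighted_FTC poly_DERIV) simp
  then show ?thesis
    by (rule has_integral_eq[rotated]) (rule eq)
qed

theorem gegenbauer_orthogonal:
  assumes l: "l > - 1 / 2" and "i \<noteq> j"
  shows "((\<lambda>x. gegenbauer_weight l x * (poly (gegenbauer l i) x * poly (gegenbauer l j) x))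
           has_integral 0) {-1<..<1}"
proof -
  define d where "d = real j * (real j + 2 * l) - real i * (real i + 2 * l)"
  have "d = (real j - real i) * (real i + real j + 2 * l)"
    by (simp add: d_def algebra_simps)
  moreover have "real i + real j \<ge> 1"
    using \<open>i \<noteq> j\<close> by linarith
  ultimately have "d \<noteq> 0"
    using assms by auto
  \<comment> \<open>The terms with derivatives agree in the identities for \<open>(i, j)\<close> and for \<open>(j, i)\<close>, and cancel.\<close>
  have "((\<lambda>x. d * (gegenbauer_weight l x * (poly (gegenbauer l i) x * poly (gegenbauer l j) x)))
           has_integral 0) {-1<..<1}"
    using has_integral_diff[OF gegenbauer_by_parts[OF l, of i j] gegenbauer_by_parts[OF l, of j i]]
    by (simp add: d_def algebra_simps)
  from has_integral_mult_right[OF this, of "1 / d"] show ?thesis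
    using \<open>d \<noteq> 0\<close> by simp
qed

text \<open>
  The squared norm in degree \<open>k + 1\<close> and parameter \<open>l\<close> from the one in degree \<open>k\<close> and parameter \<open>l + 1\<close>.
\<close>
lemma gegenbauer_norm_raise:
  assumes l: "l > - 1 / 2"
    and N: "((\<lambda>x. gegenbauer_weight (l + 1) x * (poly (gegenbauer (l + 1) k) x)\<^sup>2) has_integral N) {-1<..<1}"
  shows "((\<lambda>x. gegenbauer_weight l x * (poly (gegenbauer l (Suc k)) x)\<^sup>2)
           has_integral (real (Suc k) * (real (Suc k) + 2 * l) / (2 * l + 1)\<^sup>2 * N)) {-1<..<1}"
proof -
  define m where "m = real (Suc k) * (real (Suc k) + 2 * l)"
  have "m \<noteq> 0" "2 * l + 1 \<noteq> 0"
    using l by (auto simp: m_def)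
  have "((\<lambda>x. (m / (2 * l + 1))\<^sup>2 * (gegenbauer_weight (l + 1) x * (poly (gegenbauer (l + 1) k) x)\<^sup>2))
      has_integral ((m / (2 * l + 1))\<^sup>2 * N)) {-1<..<1}"
    by (intro has_integral_mult_right N)
  from has_integral_diff[OF this gegenbauer_by_parts[OF l, of "Suc k" "Suc k"]]
  have "((\<lambda>x. m * (gegenbauer_weight l x * (poly (gegenbauer l (Suc k)) x)\<^sup>2))
      has_integral ((m / (2 * l + 1))\<^sup>2 * N)) {-1<..<1}"
    unfolding pderiv_gegenbauer_Suc m_def[symmetric]
    by (simp add: power2_eq_square mult_ac)
  from has_integral_mult_right[OF this, of "1 / m"] show ?thesis
    unfolding m_def[symmetric] using \<open>m \<noteq> 0\<close> by (simp add: power2_eq_square mult_ac)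
qed

lemma has_integral_weight_0: "(gegenbauer_weight 0 has_integral pi) {-1<..<1}"
proof -
  have "((\<lambda>x. (1 - x\<^sup>2) powr (- 1 / 2)) has_integral (arcsin 1 - arcsin (- 1))) {-1..1}"
  proof (rule fundamental_theorem_of_calculus_interior)
    show "(arcsin has_vector_derivative (1 - x\<^sup>2) powr (- 1 / 2)) (at x)" if "x \<in> {-1<..<1}" for x :: real
    proof -
      have "1 - x\<^sup>2 > 0"
        using that by (simp add: abs_square_less_1 abs_if)
      then have "(1 - x\<^sup>2) powr (- 1 / 2) = inverse (sqrt (1 - x\<^sup>2))"
        by (simp add: powr_minus powr_half_sqrt)
      with DERIV_arcsin[of x] that show ?thesis
        by (simp add: has_real_derivative_iff_has_vector_derivative)
    qed
  qed (auto intro: continuous_on_arcsin')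
  then show ?thesis
    by (simp add: has_integral_Icc_iff_Ioo)
qed

lemma has_integral_weight_raise:
  assumes l: "l > - 1 / 2" and J: "(gegenbauer_weight l has_integral J) {-1<..<1}"
  shows "(gegenbauer_weight (l + 1) has_integral ((2 * l + 1) / (2 * l + 2) * J)) {-1<..<1}"
proof -
  have "((\<lambda>x. (1 - x\<^sup>2) powr (l + 1/2 - 1) * ((1 - x\<^sup>2) * 1 - 2 * (l + 1/2) * x * x)) has_integral 0) {-1<..<1}"
    using l by (intro weighted_FTC) auto
  from has_integral_add[OF this has_integral_mult_right[OF J, of "2 * l + 1"]]
  have "((\<lambda>x. (1 - x\<^sup>2) powr (l + 1/2 - 1) * ((1 - x\<^sup>2) * 1 - 2 * (l + 1/2) * x * x)
            + (2 * l + 1) * gegenbauer_weight l x) has_integral ((2 * l + 1) * J)) {-1<..<1}"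
    by simp
  then have "((\<lambda>x. (2 * l + 2) * gegenbauer_weight (l + 1) x) has_integral ((2 * l + 1) * J)) {-1<..<1}"
  proof (rule has_integral_eq[rotated])
    fix x :: real assume x: "x \<in> {-1<..<1}"
    have "l + 1/2 - 1 = l - 1/2"
      by simp
    then show "(1 - x\<^sup>2) powr (l + 1/2 - 1) * ((1 - x\<^sup>2) * 1 - 2 * (l + 1/2) * x * x)
        + (2 * l + 1) * gegenbauer_weight l x = (2 * l + 2) * gegenbauer_weight (l + 1) x"
      by (simp only: weight_Suc[OF x]) (simp add: algebra_simps power2_eq_square)
  qed
  from has_integral_mult_right[OF this, of "1 / (2 * l + 2)"] show ?thesis
    using l by simp
qed

lemma Gamma_half_Suc:
  "Gamma (real (Suc n) + 1/2) = (2 * real n + 1) / 2 * Gamma (real n + 1/2)"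
proof -
  have "real n + 1/2 \<notin> \<int>\<^sub>\<le>\<^sub>0"
    using nonpos_Ints_nonpos[of "real n + 1/2"] by force
  from Gamma_plus1[OF this] show ?thesis
    by (simp add: add_ac add_divide_distrib)
qed

lemma has_integral_weight:
  "(gegenbauer_weight (real n) has_integral (4 ^ n * (Gamma (real n + 1/2))\<^sup>2 / fact (2 * n))) {-1<..<1}"
proof (induction n)
  case 0
  show ?case using has_integral_weight_0 by (simp add: Gamma_one_half_real)
next
  case (Suc n)
  have "(2 * real n + 1) / (2 * real n + 2) * (4 ^ n * (Gamma (real n + 1/2))\<^sup>2 / fact (2 * n))
      = 4 ^ Suc n * (Gamma (real (Suc n) + 1/2))\<^sup>2 / fact (2 * Suc n)"
  proof -
    have "fact (2 * Suc n) = (2 * real n + 2) * ((2 * real n + 1) * fact (2 * n))"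
      by (simp add: algebra_simps)
    moreover have "2 * real n + 2 \<noteq> 0" "2 * real n + 1 \<noteq> 0" by linarith+
    ultimately show ?thesis
      unfolding Gamma_half_Suc by (simp add: divide_simps power2_eq_square)
  qed
  with has_integral_weight_raise[OF _ Suc.IH] show ?case
    by (simp add: add_ac)
qed

text \<open>
  The case \<open>n = k = 0\<close> is excluded because the denominator vanishes there; the integral is then \<open>\<pi>\<close>.
\<close>
theorem gegenbauer_norm:
  assumes "n + k \<ge> 1"
  shows "((\<lambda>x. gegenbauer_weight (real n) x * (poly (gegenbauer (real n) k) x)\<^sup>2) has_integral
           (4 ^ n * fact k * (Gamma (real n + 1/2))\<^sup>2 / (2 * (real n + real k) * fact (2 * n + k - 1)))) {-1<..<1}"
  using assms
proof (induction k arbitrary: n)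
  case 0
  then have "fact (2 * n) = 2 * real n * fact (2 * n - 1)"
    by (subst fact_reduce) auto
  with has_integral_weight[of n] show ?case
    by (simp add: mult_ac)
next
  case (Suc k)
  have "real (Suc k) * (real (Suc k) + 2 * real n) / (2 * real n + 1)\<^sup>2 *
      (4 ^ Suc n * fact k * (Gamma (real (Suc n) + 1/2))\<^sup>2 / (2 * (real (Suc n) + real k) * fact (2 * Suc n + k - 1)))
    = 4 ^ n * fact (Suc k) * (Gamma (real n + 1/2))\<^sup>2 / (2 * (real n + real (Suc k)) * fact (2 * n + Suc k - 1))"
  proof -
    have "fact (2 * Suc n + k - 1) = (real (Suc k) + 2 * real n) * fact (2 * n + Suc k - 1)"
      by (simp add: algebra_simps)
    moreover have "fact (Suc k) = real (Suc k) * fact k"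
      by simp
    moreover have "2 * real n + 1 \<noteq> 0" "real (Suc k) + 2 * real n \<noteq> 0" "real n + real (Suc k) \<noteq> 0"
      by linarith+
    ultimately show ?thesis
      unfolding Gamma_half_Suc
      by (simp add: divide_simps power2_eq_square del: of_nat_Suc fact_Suc) (simp add: algebra_simps)
  qed
  moreover have "((\<lambda>x. gegenbauer_weight (real n + 1) x * (poly (gegenbauer (real n + 1) k) x)\<^sup>2) has_integral
      (4 ^ Suc n * fact k * (Gamma (real (Suc n) + 1/2))\<^sup>2 / (2 * (real (Suc n) + real k) * fact (2 * Suc n + k - 1)))) {-1<..<1}"
    using Suc.IH[of "Suc n"] by (simp add: add_ac)
  from gegenbauer_norm_raise[OF _ this] show ?case
    using calculation by simp
qed

section \<open>Ferrers functions in terms of Gegenbauer polynomials\<close>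

theorem ferrers_P_eq_gegenbauer:
  assumes m: "m > - 1" and x: "x \<in> {-1<..<1}"
  shows "ferrers_P (real k + m) (- m) x
           = 2 powr (- m) * rGamma (m + 1) * (1 - x\<^sup>2) powr (m / 2) * poly (gegenbauer (m + 1/2) k) x"
proof -
  define t where "t = (1 - x) / 2"
  define v where "v = real k + m"
  define p where "p = hypergeo_poly k (real k + 2 * (m + 1/2)) (m + 1/2 + 1/2)"
  have t: "\<bar>t\<bar> < 1" and "1 - t = (1 + x) / 2"
    using x by (auto simp: t_def field_simps)
  have c: "m + 1 + real j \<noteq> 0" for j
    using m by linarith
  have "fps_hypergeo [- v, v + 1] [m + 1] 1 = fps_hypergeo [v + 1, - v] [m + 1] 1"
    by (simp add: fps_eq_iff)
  also have "\<dots> = fps_one_minus_powr m * fps_of_poly p"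
    using fps_hypergeo_Euler[OF c, of "v + 1" "- v"]
    by (simp add: v_def p_def fps_of_hypergeo_poly algebra_simps)
  \<comment> \<open>Here \<open>(m + 1) - (v + 1) = -k\<close>, so the transformed series terminates.\<close>
  finally have H: "fps_hypergeo [- v, v + 1] [m + 1] 1 = fps_one_minus_powr m * fps_of_poly p" .
  have "pochhammer (- v) j * pochhammer (v + 1) j * rGamma (- (- m) + 1 + real j) / fact j * t ^ j
      = rGamma (m + 1) * (fps_hypergeo [- v, v + 1] [m + 1] 1 $ j * t ^ j)" for j
  proof -
    show ?thesis
      using pochhammer_nonzero[OF c, of j] by (simp add: pochhammer_rGamma[of "m + 1" j])
  qed
  then have "(\<Sum>j. pochhammer (- v) j * pochhammer (v + 1) j * rGamma (- (- m) + 1 + real j) / fact j * t ^ j)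
      = (\<Sum>j. rGamma (m + 1) * ((fps_one_minus_powr m * fps_of_poly p) $ j * t ^ j))"
    unfolding H by simp
  also have "\<dots> = rGamma (m + 1) * eval_fps (fps_one_minus_powr m * fps_of_poly p) t"
  proof -
    have "ereal (norm t) < 1"
      using t by simp
    also have "\<dots> \<le> fps_conv_radius (fps_one_minus_powr m)"
      by (rule fps_conv_radius_one_minus_powr)
    also have "\<dots> \<le> fps_conv_radius (fps_one_minus_powr m * fps_of_poly p)"
      using fps_conv_radius_mult[of "fps_one_minus_powr m" "fps_of_poly p"] by simp
    finally show ?thesis
      unfolding eval_fps_def by (intro suminf_mult summable_fps)
  qed
  also have "eval_fps (fps_one_minus_powr m * fps_of_poly p) t = (1 - t) powr m * poly p t"
    using t less_le_trans[OF _ fps_conv_radius_one_minus_powr, of "ereal \<bar>t\<bar>" m]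
    by (subst eval_fps_mult) (auto simp: eval_fps_one_minus_powr)
  finally have series: "(\<Sum>j. pochhammer (- v) j * pochhammer (v + 1) j * rGamma (- (- m) + 1 + real j) / fact j * t ^ j)
      = rGamma (m + 1) * ((1 - t) powr m * poly p t)" .
  have "((1 - x) / (1 + x)) powr (m / 2) * ((1 + x) / 2) powr m = 2 powr (- m) * (1 - x\<^sup>2) powr (m / 2)"
  proof -
    have "1 - x\<^sup>2 = (1 - x) * (1 + x)"
      by (simp add: algebra_simps power2_eq_square)
    moreover have "(1 + x) powr m = (1 + x) powr (m / 2) * (1 + x) powr (m / 2)"
      by (simp flip: powr_add)
    ultimately show ?thesis
      using x by (simp add: powr_divide powr_mult powr_minus divide_simps)
  qed
  moreover have "ferrers_P (real k + m) (- m) x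
      = ((1 - x) / (1 + x)) powr (m / 2) * (rGamma (m + 1) * (((1 + x) / 2) powr m * poly p t))"
    using series unfolding \<open>1 - t = (1 + x) / 2\<close> unfolding ferrers_P_def v_def t_def by simp
  moreover have "poly p t = poly (gegenbauer (m + 1/2) k) x"
    by (simp add: poly_gegenbauer p_def t_def)
  ultimately show ?thesis
    by (simp add: mult_ac)
qed

text \<open>
  The assumption excludes \<open>n = k = 0\<close>, where \<open>\<Gamma>(\<nu> + \<mu> + 1) = \<Gamma>(2n + k)\<close> would be at a pole.
\<close>
lemma ferrers_Q_half_odd:
  assumes "n + k \<ge> 1"
  shows "ferrers_Q (real k + real n - 1/2) (real n - 1/2) x
           = (- 1) ^ n * pi / 2 * fact (2 * n + k - 1) / fact k
             * ferrers_P (real k + (real n - 1/2)) (- (real n - 1/2)) x"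
proof -
  have arg: "pi * (real n - 1/2) = real n * pi - pi / 2"
    by (simp add: algebra_simps)
  have "cos (pi * (real n - 1/2)) = 0" "sin (pi * (real n - 1/2)) = - ((- 1) ^ n)"
    unfolding arg by (simp_all add: cos_diff sin_diff)
  moreover have "Gamma (real k + real n - 1/2 + (real n - 1/2) + 1) = fact (2 * n + k - 1)"
    using assms Gamma_fact[of "2 * n + k - 1", where 'a = real] by (simp add: of_nat_diff add_ac)
  moreover have "Gamma (real k + real n - 1/2 - (real n - 1/2) + 1) = fact k"
    using Gamma_fact[of k, where 'a = real] by (simp add: add_ac)
  moreover have "(- 1) ^ n = (1 :: real) \<or> (- 1) ^ n = (- 1 :: real)"
    by (cases "even n") auto
  ultimately show ?thesis
    unfolding ferrers_Q_def by (auto simp: add_diff_eq)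
qed

theorem corollary2p6:
  fixes n k k' :: nat
  assumes "n + k \<ge> 1" and "n + k' \<ge> 1"
  shows "((\<lambda>x. ferrers_Q (real k + real n - 1/2) (real n - 1/2) x *
               ferrers_Q (real k' + real n - 1/2) (real n - 1/2) x)
          has_integral
          (pi\<^sup>2 * fact (2 * n + k - 1) / (4 * (real n + real k) * fact k)
             * (if k = k' then 1 else 0))) {-1<..<1}"
proof -
  define m where "m = real n - 1/2"
  define A where "A = (pi / 2 * 2 powr (- m) * rGamma (m + 1))\<^sup>2
      * (fact (2 * n + k - 1) / fact k) * (fact (2 * n + k' - 1) / fact k')"
  have Q: "ferrers_Q (real k + real n - 1/2) (real n - 1/2) x * ferrers_Q (real k' + real n - 1/2) (real n - 1/2) x
      = A * (gegenbauer_weight (real n) x * (poly (gegenbauer (real n) k) x * poly (gegenbauer (real n) k') x))"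
    if x: "x \<in> {-1<..<1}" for x
  proof -
    have P: "ferrers_P (real i + (real n - 1/2)) (- (real n - 1/2)) x
        = 2 powr (- m) * rGamma (m + 1) * (1 - x\<^sup>2) powr (m / 2) * poly (gegenbauer (real n) i) x" for i
      using ferrers_P_eq_gegenbauer[of m x i] x by (simp add: m_def)
    have "gegenbauer_weight (real n) x = (1 - x\<^sup>2) powr (m / 2) * (1 - x\<^sup>2) powr (m / 2)"
      by (simp add: m_def flip: powr_add)
    moreover have "(- 1 :: real) ^ n * (- 1) ^ n = 1"
      by (simp flip: power_mult_distrib)
    ultimately show ?thesis
      unfolding ferrers_Q_half_odd[OF assms(1)] ferrers_Q_half_odd[OF assms(2)] P A_def
      by (simp add: power2_eq_square mult_ac)
  qed
  have "((\<lambda>x. A * (gegenbauer_weight (real n) x * (poly (gegenbauer (real n) k) x * poly (gegenbauer (real n) k') x)))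
      has_integral (pi\<^sup>2 * fact (2 * n + k - 1) / (4 * (real n + real k) * fact k)
             * (if k = k' then 1 else 0))) {-1<..<1}"
  proof (cases "k = k'")
    case True
    define G where "G = Gamma (real n + 1/2)"
    have "G > 0"
      by (simp add: G_def)
    have A_eq: "A = pi\<^sup>2 / (2 * 4 ^ n * G\<^sup>2) * (fact (2 * n + k - 1) / fact k)\<^sup>2"
    proof -
      have "(2 powr (- m))\<^sup>2 = 2 powr (1 - 2 * real n)"
        by (simp add: power2_eq_square m_def flip: powr_add)
      also have "\<dots> = 2 / 4 ^ n"
        by (simp add: powr_diff powr_mult_base powr_realpow power_mult flip: powr_powr)
      finally have two: "(2 powr (- m))\<^sup>2 = 2 / 4 ^ n" .
      have "m + 1 = real n + 1/2"
        by (simp add: m_def)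
      then have "rGamma (m + 1) = 1 / G"
        by (simp only: G_def rGamma_inverse_Gamma inverse_eq_divide)
      then have "A = (pi / 2)\<^sup>2 * (2 powr (- m))\<^sup>2 * (1 / G)\<^sup>2 * (fact (2 * n + k - 1) / fact k)\<^sup>2"
        by (simp only: A_def True[symmetric] power_mult_distrib power2_eq_square[of "_ / fact k"] mult.assoc)
      then show ?thesis
        by (simp add: two power_divide)
    qed
    have "A * (4 ^ n * fact k * G\<^sup>2 / (2 * (real n + real k) * fact (2 * n + k - 1)))
        = pi\<^sup>2 * fact (2 * n + k - 1) / (4 * (real n + real k) * fact k)"
    proof -
      define d where "d = real n + real k"
      define f :: real where "f = fact (2 * n + k - 1)"
      have "d \<noteq> 0" "f \<noteq> 0"
        using assms(1) by (auto simp: d_def f_def)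
      then show ?thesis
        unfolding A_eq d_def[symmetric] f_def[symmetric] using \<open>G > 0\<close>
        by (simp add: power2_eq_square divide_simps)
    qed
    with has_integral_mult_right[OF gegenbauer_norm[OF assms(1)], of A] True show ?thesis
      by (simp add: power2_eq_square G_def)
  next
    case False
    with has_integral_mult_right[OF gegenbauer_orthogonal[of "real n" k k'], of A] show ?thesis
      by simp
  qed
  then show ?thesis
    by (rule has_integral_eq[rotated]) (rule Q[symmetric])
qed
end
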